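(* For every integer $n\ge 1$ and every finite set $A\subset\mathbb{R}^n$, letting $m:=|A|$, we have $$\sum_{i=1}^n |\pi_i(A)| \ge \sum_{i=1}^n |\pi_i(\mathcal{I}_n(m))|,$$ where $\pi_i$ is the orthogonal projection of $\mathbb{R}^n$ onto the coordinate hyperplane $x_i=0$ and $\mathcal{I}_n(m)$ is the length-$m$ initial segment of $\mathbb{N}_0^n$ with respect to the cube order.
   Context: $\mathbb{N}_0$ denotes the set of all non-negative integers, and $[a,b]$ denotes the set of integers from $a$ to $b$. For $n\ge 1$ and $i\in[1,n]$, $\pi_i$ is the orthogonal projection of $\mathbb{R}^n$ onto the coordinate hyperplane $\{(x_1,\ldots,x_n)\in\mathbb{R}^n : x_i=0\}$. (For $n=1$ the projection of any nonempty set has size $1$.) The cube order on $\mathbb{N}_0^n$ is the linear order in which $(x_1,\ldots,x_n)$ precedes $(y_1,\ldots,y_n)$ if there exist $l_0\in\mathbb{N}_0$ and $j\in[1,n]$ such that $\{i\in[1,n]: x_i=l\}=\{i\in[1,n]: y_i=l\}$ for each $l>l_0$, and also $\{i\in[j+1,n]: x_i=l_0\}=\{i\in[j+1,n]: y_i=l_0\}$, while $x_j<y_j=l_0$. For an integer $m\ge 0$, $\mathcal{I}_n(m)\subset\mathbb{N}_0^n$ denotes the length-$m$ initial segment of $\mathbb{N}_0^n$ with respect to the cube order, that is, the set of the $m$ smallest elements (with $\mathcal{I}_n(0)=\varnothing$). *)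

theory Defs
  imports Complex_Main "HOL-Library.FuncSet"
begin

text \<open>
  Vectors of length \<open>n\<close> are functions on \<open>nat\<close> with coordinates \<open>1, \<dots>, n\<close>, equal to
  \<open>undefined\<close> elsewhere, so that equality of functions is equality of vectors.
\<close>

definition rspace :: "nat \<Rightarrow> (nat \<Rightarrow> real) set" where
  "rspace n = {1..n} \<rightarrow>\<^sub>E UNIV"

definition nspace :: "nat \<Rightarrow> (nat \<Rightarrow> nat) set" where
  "nspace n = {1..n} \<rightarrow>\<^sub>E UNIV"

text \<open>The inclusion of \<open>nspace n\<close> into \<open>rspace n\<close>; \<open>restrict\<close> adjusts the junk value.\<close>

definition real_vec :: "nat \<Rightarrow> (nat \<Rightarrow> nat) \<Rightarrow> (nat \<Rightarrow> real)" where
  "real_vec n x = (\<lambda>k\<in>{1..n}. real (x k))"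

definition coord_hyperplane :: "nat \<Rightarrow> nat \<Rightarrow> (nat \<Rightarrow> real) set" where
  "coord_hyperplane n i = {x \<in> rspace n. x i = 0}"

text \<open>
  The orthogonal projection onto \<open>coord_hyperplane n i\<close>, for \<open>i\<close> in \<open>{1..n}\<close>;
  see \<open>coord_proj_orthogonal\<close> below.
\<close>

definition coord_proj :: "nat \<Rightarrow> (nat \<Rightarrow> real) \<Rightarrow> (nat \<Rightarrow> real)" where
  "coord_proj i x = x(i := 0)"

definition cube_less :: "nat \<Rightarrow> (nat \<Rightarrow> nat) \<Rightarrow> (nat \<Rightarrow> nat) \<Rightarrow> bool" where
  "cube_less n x y \<longleftrightarrow>
    (\<exists>l0. \<exists>j\<in>{1..n}.
      (\<forall>l>l0. {i\<in>{1..n}. x i = l} = {i\<in>{1..n}. y i = l}) \<and>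
      {i\<in>{j+1..n}. x i = l0} = {i\<in>{j+1..n}. y i = l0} \<and>
      x j < y j \<and> y j = l0)"

definition cube_preds :: "nat \<Rightarrow> (nat \<Rightarrow> nat) \<Rightarrow> (nat \<Rightarrow> nat) set" where
  "cube_preds n x = {y \<in> nspace n. cube_less n y x}"

text \<open>
  The \<open>m\<close> smallest elements are those with fewer than \<open>m\<close> predecessors. The finiteness
  condition, which always holds (\<open>finite_cube_preds\<close>), only guards against \<open>card\<close> being \<open>0\<close>
  on infinite sets.
\<close>

definition cube_segment :: "nat \<Rightarrow> nat \<Rightarrow> (nat \<Rightarrow> nat) set" where
  "cube_segment n m = {x \<in> nspace n. finite (cube_preds n x) \<and> card (cube_preds n x) < m}"

lemma coord_proj_orthogonal:
  assumes "i \<in> {1..n}" "x \<in> rspace n"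
  shows "coord_proj i x \<in> coord_hyperplane n i"
    and "y \<in> coord_hyperplane n i \<Longrightarrow> (\<Sum>k=1..n. (x k - coord_proj i x k) * y k) = 0"
proof -
  show "coord_proj i x \<in> coord_hyperplane n i"
    using assms by (auto simp: coord_proj_def coord_hyperplane_def rspace_def PiE_def extensional_def)
  show "(\<Sum>k=1..n. (x k - coord_proj i x k) * y k) = 0" if "y \<in> coord_hyperplane n i"
    using that by (intro sum.neutral) (auto simp: coord_proj_def coord_hyperplane_def)
qed

lemma cube_less_iff:
  "cube_less n x y \<longleftrightarrow>
    (\<exists>l0. \<exists>j\<in>{1..n}.
      (\<forall>i\<in>{1..n}. x i > l0 \<or> y i > l0 \<longrightarrow> x i = y i) \<and>
      (\<forall>i\<in>{1..n}. i > j \<longrightarrow> (x i = l0 \<longleftrightarrow> y i = l0)) \<and>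
      x j < l0 \<and> y j = l0)"
proof -
  have 1: "(\<forall>l>l0. {i\<in>{1..n}. x i = l} = {i\<in>{1..n}. y i = l}) \<longleftrightarrow>
      (\<forall>i\<in>{1..n}. x i > l0 \<or> y i > l0 \<longrightarrow> x i = y i)" for l0
  proof
    assume L: "\<forall>l>l0. {i\<in>{1..n}. x i = l} = {i\<in>{1..n}. y i = l}"
    show "\<forall>i\<in>{1..n}. x i > l0 \<or> y i > l0 \<longrightarrow> x i = y i"
    proof (intro ballI impI, erule disjE)
      fix i assume i: "i \<in> {1..n}" "x i > l0"
      then have "i \<in> {k\<in>{1..n}. y k = x i}" using L[rule_format, of "x i"] by blast
      then show "x i = y i" by simp
    next
      fix i assume i: "i \<in> {1..n}" "y i > l0"
      then have "i \<in> {k\<in>{1..n}. x k = y i}" using L[rule_format, of "y i"] by blast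
      then show "x i = y i" by simp
    qed
  next
    assume R: "\<forall>i\<in>{1..n}. x i > l0 \<or> y i > l0 \<longrightarrow> x i = y i"
    show "\<forall>l>l0. {i\<in>{1..n}. x i = l} = {i\<in>{1..n}. y i = l}"
    proof (intro allI impI Collect_cong conj_cong refl)
      fix l i assume "l > l0" "i \<in> {1..n}"
      with R[rule_format, of i] show "x i = l \<longleftrightarrow> y i = l" by linarith
    qed
  qed
  have 2: "{i\<in>{j+1..n}. x i = l0} = {i\<in>{j+1..n}. y i = l0} \<longleftrightarrow>
      (\<forall>i\<in>{1..n}. i > j \<longrightarrow> (x i = l0 \<longleftrightarrow> y i = l0))" for l0 j
  proof -
    have "i \<in> {j+1..n} \<longleftrightarrow> i \<in> {1..n} \<and> i > j" for i by auto
    then show ?thesis unfolding set_eq_iff mem_Collect_eq by blast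
  qed
  have 3: "x j < y j \<and> y j = l0 \<longleftrightarrow> x j < l0 \<and> y j = l0" for l0 j
    by auto
  show ?thesis unfolding cube_less_def 1 2 3 by (rule refl)
qed

lemma cube_less_irrefl: "\<not> cube_less n x x"
  by (auto simp: cube_less_def)

lemma cube_less_trans:
  assumes "cube_less n x y" "cube_less n y z"
  shows "cube_less n x z"
proof -
  from assms(1) obtain l j where j: "j \<in> {1..n}" and
    xy: "\<And>i. i \<in> {1..n} \<Longrightarrow> (x i > l \<or> y i > l \<longrightarrow> x i = y i) \<and> (i > j \<longrightarrow> (x i = l \<longleftrightarrow> y i = l))"
    and lj: "x j < l" "y j = l"
    unfolding cube_less_iff by blast
  from assms(2) obtain l' k where k: "k \<in> {1..n}" and
    yz: "\<And>i. i \<in> {1..n} \<Longrightarrow> (y i > l' \<or> z i > l' \<longrightarrow> y i = z i) \<and> (i > k \<longrightarrow> (y i = l' \<longleftrightarrow> z i = l'))"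
    and lk: "y k < l'" "z k = l'"
    unfolding cube_less_iff by blast
  have I: ?thesis if "p \<in> {1..n}" "x p < L" "z p = L"
    "\<And>i. i \<in> {1..n} \<Longrightarrow> (x i > L \<or> z i > L \<longrightarrow> x i = z i) \<and> (i > p \<longrightarrow> (x i = L \<longleftrightarrow> z i = L))" for L p
    using that unfolding cube_less_iff by blast
  consider "l < l' \<or> l = l' \<and> j < k" | "l' < l \<or> l = l' \<and> k < j" | "l = l'" "j = k"
    by linarith
  then show ?thesis
  proof cases
    case 1
    have "x k < l'" using 1 xy[OF k] yz[OF k] lk by linarith
    moreover have "(x i > l' \<or> z i > l' \<longrightarrow> x i = z i) \<and> (i > k \<longrightarrow> (x i = l' \<longleftrightarrow> z i = l'))"
      if "i \<in> {1..n}" for i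
      using 1 xy[OF that] yz[OF that] by linarith
    ultimately show ?thesis using I k lk by blast
  next
    case 2
    have "z j = l" using 2 xy[OF j] yz[OF j] lj by linarith
    moreover have "(x i > l \<or> z i > l \<longrightarrow> x i = z i) \<and> (i > j \<longrightarrow> (x i = l \<longleftrightarrow> z i = l))"
      if "i \<in> {1..n}" for i
      using 2 xy[OF that] yz[OF that] by linarith
    ultimately show ?thesis using I j lj by blast
  next
    case 3
    with lj lk show ?thesis by simp
  qed
qed

lemma cube_less_linear:
  assumes "x \<in> nspace n" "y \<in> nspace n" "x \<noteq> y"
  shows "cube_less n x y \<or> cube_less n y x"
proof -
  define D where "D = {i\<in>{1..n}. x i \<noteq> y i}"
  define M where "M i = max (x i) (y i)" for i
  define l where "l = Max (M ` D)"
  define E where "E = {i\<in>D. M i = l}"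
  define j where "j = Max E"
  have "finite D" by (simp add: D_def)
  have "D \<noteq> {}"
  proof
    assume "D = {}"
    then have "x i = y i" if "i \<in> {1..n}" for i using that by (simp add: D_def)
    then have "x = y" by (rule PiE_ext[OF assms(1,2)[unfolded nspace_def]])
    with assms(3) show False ..
  qed
  have le: "M i \<le> l" if "i \<in> D" for i
    using that \<open>finite D\<close> by (simp add: l_def)
  have "l \<in> M ` D" unfolding l_def using \<open>finite D\<close> \<open>D \<noteq> {}\<close> by simp
  then have "E \<noteq> {}" "finite E" using \<open>finite D\<close> by (auto simp: E_def)
  then have "j \<in> E" unfolding j_def by simp
  then have j: "j \<in> {1..n}" "x j \<noteq> y j" "max (x j) (y j) = l"
    by (auto simp: E_def D_def M_def)
  have above: "x i = y i" if "i \<in> {1..n}" "x i > l \<or> y i > l" for i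
  proof (rule ccontr)
    assume "x i \<noteq> y i"
    with that(1) have "i \<in> D" by (simp add: D_def)
    from le[OF this] that(2) show False by (auto simp: M_def)
  qed
  have right: "x i = l \<longleftrightarrow> y i = l" if "i \<in> {1..n}" "i > j" for i
  proof (rule ccontr)
    assume *: "\<not> ?thesis"
    then have "i \<in> D" using that by (auto simp: D_def)
    with * le[OF this] have "i \<in> E" by (auto simp: E_def M_def)
    then have "i \<le> j" using \<open>finite E\<close> by (simp add: j_def)
    with that show False by simp
  qed
  show ?thesis
  proof (cases "x j < y j")
    case True
    then have "x j < l" "y j = l" using j(3) by auto
    then have "cube_less n x y"
      unfolding cube_less_iff
      by (intro exI[of _ l] bexI[of _ j] conjI ballI impI above right j(1))
    then show ?thesis ..
  next
    case False
    then have "y j < l" "x j = l" using j(2,3) by auto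
    then have "cube_less n y x"
      unfolding cube_less_iff
      by (intro exI[of _ l] bexI[of _ j] conjI ballI impI above[symmetric] right[symmetric] j(1)) auto
    then show ?thesis ..
  qed
qed

lemma finite_cube_preds: "finite (cube_preds n x)"
proof -
  define b where "b = (\<Sum>i=1..n. x i)"
  have "y i \<le> b" if "cube_less n y x" "i \<in> {1..n}" for y i
  proof -
    from that obtain l j where a: "j \<in> {1..n}" "x j = l" "y i > l \<Longrightarrow> y i = x i"
      unfolding cube_less_iff by blast
    have "x j \<le> b" "x i \<le> b"
      unfolding b_def using a(1) that(2) by (auto intro!: member_le_sum)
    with a show ?thesis by (cases "y i > l") auto
  qed
  then have "cube_preds n x \<subseteq> {1..n} \<rightarrow>\<^sub>E {..b}"
    by (auto simp: cube_preds_def nspace_def PiE_def Pi_def)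
  then show ?thesis by (rule finite_subset) (simp add: finite_PiE)
qed

lemma cube_segment_downward:
  assumes "x \<in> cube_segment n m" "y \<in> nspace n" "cube_less n y x"
  shows "y \<in> cube_segment n m"
proof -
  have "cube_preds n y \<subseteq> cube_preds n x"
    using assms(3) by (auto simp: cube_preds_def intro: cube_less_trans)
  then have "card (cube_preds n y) \<le> card (cube_preds n x)"
    by (rule card_mono[OF finite_cube_preds])
  with assms show ?thesis by (auto simp: cube_segment_def finite_cube_preds)
qed

lemma card_cube_segment:
  assumes "n \<ge> 1"
  shows "finite (cube_segment n m)" "card (cube_segment n m) = m"
proof -
  define r where "r x = card (cube_preds n x)" for x
  have mono: "r y < r x" if "y \<in> nspace n" "cube_less n y x" for x y
    unfolding r_def
  proof (rule psubset_card_mono[OF finite_cube_preds])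
    show "cube_preds n y \<subset> cube_preds n x"
      using that cube_less_irrefl[of n y] by (auto simp: cube_preds_def intro: cube_less_trans)
  qed
  have inj: "inj_on r (nspace n)"
    by (rule inj_onI) (metis cube_less_linear mono less_irrefl)
  have "infinite (nspace n)"
  proof
    assume fin: "finite (nspace n)"
    have "inj (\<lambda>a::nat. \<lambda>k\<in>{1..n}. a)"
      using assms by (intro injI) (auto dest!: fun_cong[of _ _ 1])
    moreover have "range (\<lambda>a::nat. \<lambda>k\<in>{1..n}. a) \<subseteq> nspace n"
      by (auto simp: nspace_def)
    ultimately show False using fin finite_subset finite_imageD infinite_UNIV_nat by blast
  qed
  then have "infinite (r ` nspace n)" using inj finite_imageD by blast
  have surj: "\<exists>x\<in>nspace n. r x = k" for k
  proof -
    obtain x where x: "x \<in> nspace n" "k < r x"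
      using \<open>infinite (r ` nspace n)\<close> unfolding finite_nat_set_iff_bounded_le by (auto simp: not_le)
    have "cube_preds n x \<subseteq> nspace n" by (auto simp: cube_preds_def)
    then have "card (r ` cube_preds n x) = r x"
      using inj card_image[of r "cube_preds n x"] inj_on_subset by (auto simp: r_def)
    moreover have "r ` cube_preds n x \<subseteq> {..<r x}"
      using mono by (auto simp: cube_preds_def)
    ultimately have "r ` cube_preds n x = {..<r x}"
      by (intro card_subset_eq) auto
    with x have "k \<in> r ` cube_preds n x" by auto
    then show ?thesis by (auto simp: cube_preds_def)
  qed
  have sub: "cube_segment n m \<subseteq> nspace n" by (auto simp: cube_segment_def)
  have "r ` cube_segment n m = {..<m}"
  proof (rule set_eqI, rule iffI)
    fix k assume "k \<in> {..<m}"
    moreover obtain x where "x \<in> nspace n" "r x = k" using surj by blast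
    ultimately show "k \<in> r ` cube_segment n m"
      by (auto simp: cube_segment_def finite_cube_preds r_def)
  qed (auto simp: cube_segment_def r_def)
  moreover have "inj_on r (cube_segment n m)" using inj sub inj_on_subset by blast
  ultimately have "bij_betw r (cube_segment n m) {..<m}" by (simp add: bij_betw_def)
  then show "finite (cube_segment n m)" "card (cube_segment n m) = m"
    using bij_betw_finite bij_betw_same_card by fastforce+
qed

end

theory Submission imports Defs begin

text \<open>
  Two reductions set the stage. Projection sizes depend only on which coordinates of the points
  coincide, so relabelling the coordinates injectively by naturals turns \<open>A\<close> into a finite subset
  of \<open>nspace n\<close> (\<open>coordinatewise_relabelling\<close>). And for the induction on the dimension it is
  convenient to stay inside \<open>nspace n\<close> and to let the dimension be the size of a set \<open>I\<close> of
  coordinates outside of which vectors vanish: the cube order of a lower dimension is then the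
  restriction of the one order \<open>cube_less n\<close>, and projecting along \<open>i\<close> simply leads from \<open>I\<close> to
  \<open>I - {i}\<close>.

  The heart is \<open>shadow_sum_segment_le\<close>. In dimension at least two, a set that is
  not an initial segment can always be replaced by one of the same size, with smaller or equal sum
  of projections, that is lower in the order as measured by the sum over its points of their
  numbers of predecessors. There are two kinds of replacement.

  \<^item> Compression. Replace each section \<open>x i = t\<close> by the initial segment of the same size. The
    projections along the other directions do not grow, section by section, by the induction
    hypothesis; the projection along \<open>i\<close> is the union of the projected sections, and it does not
    grow because initial segments are nested, so that their union is the largest one. This
    replacement makes progress unless all sections of the set, in all directions, are initial
    segments already.

  \<^item> Exchange. If all sections are initial, then the set is closed under decreasing coordinates,
    and for such a set the projection along \<open>i\<close> is the set of its points with \<open>x i = 0\<close>. The quantity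
    to be minimised is therefore the total number of zero coordinates of its points
    (\<open>shadow_sum_down_closed\<close>). Let \<open>x\<close> be the first missing point and \<open>y\<close> the last point present,
    and suppose that \<open>x\<close> precedes \<open>y\<close>. They agree in no coordinate, and in fact
    \<open>x k > y k\<close> for all \<open>k\<close> but one exceptional \<open>j\<close> (\<open>first_gap_vs_last_point\<close>). Hence \<open>x\<close> has a zero
    at most at \<open>j\<close>, and exchanging \<open>y\<close> for \<open>x\<close> does no harm unless \<open>x j = 0\<close> while \<open>y\<close> has no zero.
    In that case, let \<open>y p\<close> be the least coordinate of \<open>y\<close>. The last points of the set are obtained
    from \<open>y\<close> by lowering this coordinate down to zero, and the first missing points are obtained
    from \<open>x\<close> by raising coordinate \<open>j\<close> from \<open>0\<close> to \<open>y p\<close>. Exchanging these two runs removes at least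
    one zero and adds exactly one (\<open>exchange_decreases_weight\<close>).
\<close>

section \<open>The cube order on vectors supported on a set of coordinates\<close>

definition supported :: "nat \<Rightarrow> nat set \<Rightarrow> (nat \<Rightarrow> nat) set" where
  "supported n I = {x \<in> nspace n. \<forall>k\<in>{1..n} - I. x k = 0}"

definition initial :: "nat \<Rightarrow> nat set \<Rightarrow> (nat \<Rightarrow> nat) set \<Rightarrow> bool" where
  "initial n I S \<longleftrightarrow> S \<subseteq> supported n I \<and>
    (\<forall>x\<in>supported n I. \<forall>y\<in>S. cube_less n x y \<longrightarrow> x \<in> S)"

definition rank :: "nat \<Rightarrow> nat set \<Rightarrow> (nat \<Rightarrow> nat) \<Rightarrow> nat" where
  "rank n I x = card {y \<in> supported n I. cube_less n y x}"

definition segment :: "nat \<Rightarrow> nat set \<Rightarrow> nat \<Rightarrow> (nat \<Rightarrow> nat) set" where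
  "segment n I m = {x \<in> supported n I. rank n I x < m}"

definition shadow :: "nat \<Rightarrow> (nat \<Rightarrow> nat) set \<Rightarrow> (nat \<Rightarrow> nat) set" where
  "shadow i A = (\<lambda>x. x(i := 0)) ` A"

definition shadow_sum :: "nat set \<Rightarrow> (nat \<Rightarrow> nat) set \<Rightarrow> nat" where
  "shadow_sum I A = (\<Sum>i\<in>I. card (shadow i A))"

lemma supported_nspace: "x \<in> supported n I \<Longrightarrow> x \<in> nspace n"
  by (simp add: supported_def)

lemma supported_eqI:
  assumes "x \<in> supported n I" "y \<in> supported n I" "\<And>i. i \<in> I \<Longrightarrow> x i = y i"
  shows "x = y"
proof (rule PiE_ext[of x "{1..n}" "\<lambda>_. UNIV" y])
  show "x i = y i" if "i \<in> {1..n}" for i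
    using assms that by (cases "i \<in> I") (auto simp: supported_def)
qed (use assms in \<open>auto simp: supported_def nspace_def\<close>)

lemma supported_update:
  assumes "x \<in> supported n I" "i \<in> I" "I \<subseteq> {1..n}"
  shows "x(i := t) \<in> supported n I"
  using assms by (auto simp: supported_def nspace_def PiE_def extensional_def)

lemma supported_remove:
  assumes "x \<in> supported n I" "i \<in> I" "I \<subseteq> {1..n}"
  shows "x(i := 0) \<in> supported n (I - {i})"
  using assms by (auto simp: supported_def nspace_def PiE_def extensional_def Ball_def)

lemma supported_insert:
  assumes "v \<in> supported n (I - {i})" "i \<in> I" "I \<subseteq> {1..n}"
  shows "v(i := t) \<in> supported n I" "v i = 0"
  using assms by (auto simp: supported_def nspace_def PiE_def extensional_def)

lemma cube_less_if_le:
  assumes "x \<in> supported n I" "y \<in> supported n I" "x \<noteq> y" "\<And>i. i \<in> I \<Longrightarrow> x i \<le> y i"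
  shows "cube_less n x y"
proof (rule ccontr)
  assume "\<not> cube_less n x y"
  then have "cube_less n y x"
    using cube_less_linear assms supported_nspace by blast
  then obtain j where "j \<in> {1..n}" "y j < x j"
    unfolding cube_less_def by blast
  with assms show False
    by (cases "j \<in> I") (force simp: supported_def)+
qed

lemma cube_lessI:
  assumes "j \<in> {1..n}" "x j < l" "y j = l"
    and "\<And>i. i \<in> {1..n} \<Longrightarrow> x i > l \<or> y i > l \<Longrightarrow> x i = y i"
    and "\<And>i. i \<in> {1..n} \<Longrightarrow> i > j \<Longrightarrow> x i = l \<longleftrightarrow> y i = l"
  shows "cube_less n x y"
  unfolding cube_less_iff using assms by blast

text \<open>
  A common coordinate is irrelevant to the comparison, so each section \<open>x i = t\<close> carries the same
  order as its projection along \<open>i\<close>.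
\<close>
lemma cube_less_update:
  assumes "x i = y i" "cube_less n x y"
  shows "cube_less n (x(i := t)) (y(i := t))"
proof -
  from assms(2) obtain l j where j: "j \<in> {1..n}" "x j < l" "y j = l"
    and above: "\<And>k. k \<in> {1..n} \<Longrightarrow> x k > l \<or> y k > l \<Longrightarrow> x k = y k"
    and right: "\<And>k. k \<in> {1..n} \<Longrightarrow> k > j \<Longrightarrow> x k = l \<longleftrightarrow> y k = l"
    unfolding cube_less_iff by blast
  have "j \<noteq> i" using j assms(1) by auto
  show ?thesis
  proof (rule cube_lessI[of j n _ l])
    show "(x(i := t)) k = (y(i := t)) k"
      if "k \<in> {1..n}" "(x(i := t)) k > l \<or> (y(i := t)) k > l" for k
      using that above[of k] by (cases "k = i") auto
    show "(x(i := t)) k = l \<longleftrightarrow> (y(i := t)) k = l" if "k \<in> {1..n}" "k > j" for k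
      using that right[of k] by (cases "k = i") auto
  qed (use j \<open>j \<noteq> i\<close> in auto)
qed

lemma card_cube_preds_mono:
  assumes "x \<in> nspace n" "cube_less n x y"
  shows "card (cube_preds n x) < card (cube_preds n y)"
proof (rule psubset_card_mono[OF finite_cube_preds])
  show "cube_preds n x \<subset> cube_preds n y"
    using assms cube_less_irrefl[of n x] by (auto simp: cube_preds_def intro: cube_less_trans)
qed

lemma finite_supported_preds: "finite {y \<in> supported n I. cube_less n y x}"
  by (rule finite_subset[OF _ finite_cube_preds[of n x]]) (auto simp: cube_preds_def supported_def)

lemma rank_mono:
  assumes "x \<in> supported n I" "cube_less n x y"
  shows "rank n I x < rank n I y"
  unfolding rank_def
proof (rule psubset_card_mono[OF finite_supported_preds])
  show "{u \<in> supported n I. cube_less n u x} \<subset> {u \<in> supported n I. cube_less n u y}"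
    using assms cube_less_irrefl[of n x] by (auto intro: cube_less_trans)
qed

lemma inj_on_rank: "inj_on (rank n I) (supported n I)"
  by (rule inj_onI) (metis cube_less_linear rank_mono less_irrefl supported_nspace)

lemma initial_segment: "initial n I (segment n I m)"
  using rank_mono by (fastforce simp: initial_def segment_def)

lemma finite_segment: "finite (segment n I m)"
  and card_segment_le: "card (segment n I m) \<le> m"
proof -
  have inj: "inj_on (rank n I) (segment n I m)"
    using inj_on_rank by (rule inj_on_subset) (auto simp: segment_def)
  have im: "rank n I ` segment n I m \<subseteq> {..<m}" by (auto simp: segment_def)
  show "finite (segment n I m)" using inj im by (rule inj_on_finite) simp
  show "card (segment n I m) \<le> m" using card_inj_on_le[OF inj im] by simp
qed

text \<open>
  The set \<open>B\<close> guarantees that there are enough points, as \<open>supported n I\<close> is a singleton if \<open>I\<close> is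
  empty. Since ranks are injective, some point of \<open>B\<close> has rank at least \<open>k\<close> for each
  \<open>k < card B\<close>, and its predecessors take all the smaller ranks.
\<close>
lemma card_segment:
  assumes "finite B" "B \<subseteq> supported n I"
  shows "card (segment n I (card B)) = card B"
proof (rule antisym[OF card_segment_le])
  let ?r = "rank n I"
  have "{..<card B} \<subseteq> ?r ` segment n I (card B)"
  proof
    fix k assume k: "k \<in> {..<card B}"
    have "\<not> ?r ` B \<subseteq> {..<k}"
    proof
      assume "?r ` B \<subseteq> {..<k}"
      then have "card B \<le> k"
        using card_inj_on_le[OF inj_on_subset[OF inj_on_rank assms(2)], of "{..<k}"] by simp
      with k show False by simp
    qed
    then obtain b where b: "b \<in> B" "k \<le> ?r b"
      unfolding image_subset_iff lessThan_iff not_less[symmetric] by blast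
    let ?P = "{y \<in> supported n I. cube_less n y b}"
    have "card (?r ` ?P) = ?r b"
      unfolding rank_def[of n I b]
      by (rule card_image[OF inj_on_subset[OF inj_on_rank]]) auto
    moreover have "?r ` ?P \<subseteq> {..<?r b}" using rank_mono by auto
    ultimately have "?r ` ?P = {..<?r b}" by (intro card_subset_eq) auto
    then have "k \<in> ?r ` insert b ?P" using b(2) by (cases "k = ?r b") auto
    then show "k \<in> ?r ` segment n I (card B)"
      using k b(1) assms(2) by (auto simp: segment_def)
  qed
  then have "card {..<card B} \<le> card (segment n I (card B))"
    by (rule surj_card_le[OF finite_segment])
  then show "card B \<le> card (segment n I (card B))" by simp
qed

lemma initial_unique:
  assumes "initial n I S" "initial n I T" "finite S" "finite T" "card S = card T"
  shows "S = T"
proof -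
  have "S \<subseteq> T \<or> T \<subseteq> S"
  proof (rule ccontr)
    assume "\<not> ?thesis"
    then obtain x y where x: "x \<in> S" "x \<notin> T" and y: "y \<in> T" "y \<notin> S" by blast
    then have "x \<in> supported n I" "y \<in> supported n I" "x \<noteq> y"
      using assms(1,2) by (auto simp: initial_def)
    with x y assms(1,2) cube_less_linear[of x n y] show False
      unfolding initial_def using supported_nspace by blast
  qed
  then show ?thesis using card_subset_eq assms by metis
qed

text \<open>
  Every point of \<open>S - B\<close> precedes every point of \<open>B - S\<close>, so any bijection between these
  differences increases \<open>w\<close> pointwise.
\<close>
lemma initial_sum_less:
  fixes w :: "(nat \<Rightarrow> nat) \<Rightarrow> nat"
  assumes S: "initial n I S" "finite S" and B: "B \<subseteq> supported n I" "finite B"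
    and "card S = card B" "S \<noteq> B"
    and w: "\<And>x y. x \<in> supported n I \<Longrightarrow> y \<in> supported n I \<Longrightarrow> cube_less n x y \<Longrightarrow> w x < w y"
  shows "sum w S < sum w B"
proof -
  have "card (S - B) = card (B - S)"
    using assms(2,4,5) by (simp add: card_Diff_subset_Int Int_commute)
  then obtain f where f: "bij_betw f (S - B) (B - S)"
    using S B finite_same_card_bij by blast
  have "S - B \<noteq> {}"
    using card_subset_eq[OF B(2), of S] assms(5,6) by auto
  have "sum w (S - B) < sum (\<lambda>x. w (f x)) (S - B)"
  proof (rule sum_strict_mono)
    fix x assume x: "x \<in> S - B"
    then have fx: "f x \<in> B - S" using f by (auto simp: bij_betw_def)
    have "x \<in> supported n I" "f x \<in> supported n I"
      using x fx S B by (auto simp: initial_def)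
    moreover from this have "cube_less n x (f x)"
    proof -
      have "\<not> cube_less n (f x) x"
        using x fx S(1) \<open>f x \<in> supported n I\<close> unfolding initial_def by blast
      moreover have "x \<noteq> f x" using x fx by auto
      ultimately show ?thesis
        using cube_less_linear \<open>x \<in> supported n I\<close> \<open>f x \<in> supported n I\<close> supported_nspace by blast
    qed
    ultimately show "w x < w (f x)" by (rule w)
  qed (use S \<open>S - B \<noteq> {}\<close> in auto)
  also have "\<dots> = sum w (B - S)" by (rule sum.reindex_bij_betw[OF f])
  finally show ?thesis
    using sum.Int_Diff[OF S(2), of w B] sum.Int_Diff[OF B(2), of w S] by (simp add: Int_commute)
qed

section \<open>Compression of sections to initial segments\<close>

definition slice :: "nat \<Rightarrow> nat \<Rightarrow> (nat \<Rightarrow> nat) set \<Rightarrow> (nat \<Rightarrow> nat) set" where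
  "slice i t A = {a \<in> A. a i = t}"

definition compress :: "nat \<Rightarrow> nat set \<Rightarrow> nat \<Rightarrow> (nat \<Rightarrow> nat) set \<Rightarrow> (nat \<Rightarrow> nat) set" where
  "compress n I i A =
    {u \<in> supported n I. rank n (I - {i}) (u(i := 0)) < card (slice i (u i) A)}"

lemma inj_on_slice: "inj_on (\<lambda>x. x(i := 0)) (slice i t A)"
proof (rule inj_onI)
  fix x y assume "x \<in> slice i t A" "y \<in> slice i t A" "x(i := 0) = y(i := 0)"
  then show "x = y"
    unfolding slice_def by (metis (mono_tags, lifting) fun_upd_triv fun_upd_upd mem_Collect_eq)
qed

lemma card_shadow_slice: "card (shadow i (slice i t A)) = card (slice i t A)"
  unfolding shadow_def by (rule card_image[OF inj_on_slice])

lemma sum_shadow_slice: "(\<Sum>v\<in>shadow i (slice i t A). w (v(i := t))) = sum w (slice i t A)"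
  unfolding shadow_def sum.reindex[OF inj_on_slice]
  by (rule sum.cong) (auto simp: slice_def)

lemma sum_slices:
  fixes w :: "(nat \<Rightarrow> nat) \<Rightarrow> nat"
  assumes "finite A" "finite T" "(\<lambda>a. a i) ` A \<subseteq> T"
  shows "(\<Sum>t\<in>T. sum w (slice i t A)) = sum w A"
  unfolding slice_def by (rule sum.group[OF assms])

lemma card_slices:
  assumes "finite A" "finite T" "(\<lambda>a. a i) ` A \<subseteq> T"
  shows "(\<Sum>t\<in>T. card (slice i t A)) = card A"
  using sum_slices[OF assms, of "\<lambda>_. 1"] by simp

lemma card_shadow_slices:
  assumes "finite A" "finite T" "(\<lambda>a. a i) ` A \<subseteq> T" "j \<noteq> i"
  shows "(\<Sum>t\<in>T. card (shadow j (shadow i (slice i t A)))) = card (shadow j A)"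
proof -
  have "shadow j (shadow i (slice i t A)) = shadow i (slice i t (shadow j A))" for t
    using assms(4) by (fastforce simp: shadow_def slice_def image_iff fun_upd_twist)
  moreover have "(\<lambda>a. a i) ` shadow j A \<subseteq> T"
    using assms(3,4) by (auto simp: shadow_def)
  moreover have "finite (shadow j A)" using assms(1) by (simp add: shadow_def)
  ultimately show ?thesis
    using assms(2) by (simp add: card_shadow_slice card_slices)
qed

lemma shadow_slice_compress:
  assumes "i \<in> I" "I \<subseteq> {1..n}"
  shows "shadow i (slice i t (compress n I i A)) = segment n (I - {i}) (card (slice i t A))"
proof
  show "shadow i (slice i t (compress n I i A)) \<subseteq> segment n (I - {i}) (card (slice i t A))"
    using supported_remove[OF _ assms] by (auto simp: shadow_def slice_def compress_def segment_def)
  show "segment n (I - {i}) (card (slice i t A)) \<subseteq> shadow i (slice i t (compress n I i A))"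
  proof
    fix v assume v: "v \<in> segment n (I - {i}) (card (slice i t A))"
    then have "v(i := t) \<in> supported n I" "v i = 0"
      using supported_insert[OF _ assms] by (auto simp: segment_def)
    moreover from \<open>v i = 0\<close> have eq: "(v(i := t))(i := 0) = v" by (metis fun_upd_triv fun_upd_upd)
    ultimately have "v(i := t) \<in> slice i t (compress n I i A)"
      using v unfolding slice_def compress_def segment_def by simp
    then show "v \<in> shadow i (slice i t (compress n I i A))"
      unfolding shadow_def using eq by (metis image_eqI)
  qed
qed

lemma shadow_slice_supported:
  assumes "i \<in> I" "I \<subseteq> {1..n}" "A \<subseteq> supported n I"
  shows "shadow i (slice i t A) \<subseteq> supported n (I - {i})"
  using supported_remove[OF _ assms(1,2)] assms(3) by (auto simp: shadow_def slice_def)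

lemma card_slice_compress:
  assumes "i \<in> I" "I \<subseteq> {1..n}" "A \<subseteq> supported n I" "finite A"
  shows "card (slice i t (compress n I i A)) = card (slice i t A)"
  using card_segment[OF _ shadow_slice_supported[OF assms(1,2,3)], of t] assms(4)
  unfolding card_shadow_slice[symmetric, of i t "compress n I i A"] shadow_slice_compress[OF assms(1,2)]
  by (simp add: card_shadow_slice) (simp add: shadow_def slice_def)

text \<open>
  Empty sections stay empty, so sums over the sections of a set and of its compression can be
  taken over the same levels.
\<close>
lemma levels_compress: "(\<lambda>a. a i) ` compress n I i A \<subseteq> (\<lambda>a. a i) ` A"
proof
  fix t assume "t \<in> (\<lambda>a. a i) ` compress n I i A"
  then have "card (slice i t A) \<noteq> 0" by (auto simp: compress_def)
  then have "slice i t A \<noteq> {}" by auto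
  then show "t \<in> (\<lambda>a. a i) ` A" by (auto simp: slice_def)
qed

lemma finite_compress:
  assumes "i \<in> I" "I \<subseteq> {1..n}" "finite A"
  shows "finite (compress n I i A)"
proof -
  have "finite (slice i t (compress n I i A))" for t
    by (rule finite_imageD[OF _ inj_on_slice])
      (simp add: shadow_def[symmetric] shadow_slice_compress[OF assms(1,2)] finite_segment)
  moreover have "compress n I i A \<subseteq> (\<Union>t\<in>(\<lambda>a. a i) ` A. slice i t (compress n I i A))"
    using levels_compress[of i n I A] by (auto simp: slice_def)
  ultimately show ?thesis
    using assms(3) by (meson finite_UN_I finite_imageI finite_subset)
qed

lemma card_compress:
  assumes "i \<in> I" "I \<subseteq> {1..n}" "A \<subseteq> supported n I" "finite A"
  shows "card (compress n I i A) = card A"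
  using card_slices[OF finite_compress[OF assms(1,2,4)] _ levels_compress]
    card_slices[OF assms(4) _ order_refl] assms(4)
  by (simp add: card_slice_compress[OF assms])

text \<open>
  The sections of the compression, projected along \<open>i\<close>, are nested, so their union is no larger
  than the largest section of \<open>A\<close>, which embeds into the projection of \<open>A\<close>.
\<close>
lemma card_shadow_compress_le:
  assumes "i \<in> I" "I \<subseteq> {1..n}" "A \<subseteq> supported n I" "finite A"
  shows "card (shadow i (compress n I i A)) \<le> card (shadow i A)"
proof (cases "A = {}")
  case True
  then have "compress n I i A = {}" using card_compress[OF assms] finite_compress[OF assms(1,2,4)] by simp
  then show ?thesis by (simp add: shadow_def)
next
  case False
  let ?c = "\<lambda>a. card (slice i (a i) A)"
  define M where "M = Max (?c ` A)"
  have "M \<in> ?c ` A" using False assms(4) by (simp add: M_def)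
  then obtain a where a: "M = card (slice i (a i) A)" by blast
  have "shadow i (compress n I i A) \<subseteq> segment n (I - {i}) M"
  proof
    fix v assume "v \<in> shadow i (compress n I i A)"
    then obtain u where u: "u \<in> compress n I i A" "v = u(i := 0)" by (auto simp: shadow_def)
    then obtain b where b: "b \<in> A" "u i = b i" using levels_compress[of i n I A] by blast
    then have "?c b \<le> M" using assms(4) by (simp add: M_def)
    then show "v \<in> segment n (I - {i}) M"
      using u b supported_remove[OF _ assms(1,2)] by (auto simp: compress_def segment_def)
  qed
  then have "card (shadow i (compress n I i A)) \<le> M"
    using card_mono[OF finite_segment] card_segment_le le_trans by blast
  also have "M = card (shadow i (slice i (a i) A))" by (simp add: a card_shadow_slice)
  also have "\<dots> \<le> card (shadow i A)"
    using assms(4) by (intro card_mono) (auto simp: shadow_def slice_def)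
  finally show ?thesis .
qed

lemma shadow_sum_remove:
  assumes "finite I" "i \<in> I"
  shows "shadow_sum I A = card (shadow i A) + shadow_sum (I - {i}) A"
  unfolding shadow_sum_def by (rule sum.remove[OF assms])

lemma shadow_sum_slices:
  assumes "finite A" "finite T" "(\<lambda>a. a i) ` A \<subseteq> T" "i \<notin> J"
  shows "(\<Sum>t\<in>T. shadow_sum J (shadow i (slice i t A))) = shadow_sum J A"
proof -
  have "(\<Sum>t\<in>T. card (shadow j (shadow i (slice i t A)))) = card (shadow j A)" if "j \<in> J" for j
    using that assms by (intro card_shadow_slices) auto
  then show ?thesis
    unfolding shadow_sum_def by (subst sum.swap) simp
qed

lemma shadow_sum_compress_le:
  assumes "i \<in> I" "I \<subseteq> {1..n}" "A \<subseteq> supported n I" "finite A"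
    and IH: "\<And>B. finite B \<Longrightarrow> B \<subseteq> supported n (I - {i}) \<Longrightarrow>
      shadow_sum (I - {i}) (segment n (I - {i}) (card B)) \<le> shadow_sum (I - {i}) B"
  shows "shadow_sum I (compress n I i A) \<le> shadow_sum I A"
proof -
  let ?C = "compress n I i A" and ?J = "I - {i}" and ?T = "(\<lambda>a. a i) ` A"
  have "shadow_sum ?J (shadow i (slice i t ?C)) \<le> shadow_sum ?J (shadow i (slice i t A))" for t
    unfolding shadow_slice_compress[OF assms(1,2)] card_shadow_slice[symmetric, of i t A]
    by (rule IH[OF _ shadow_slice_supported[OF assms(1-3)]]) (simp add: assms(4) shadow_def slice_def)
  then have "(\<Sum>t\<in>?T. shadow_sum ?J (shadow i (slice i t ?C))) \<le>
      (\<Sum>t\<in>?T. shadow_sum ?J (shadow i (slice i t A)))"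
    by (rule sum_mono)
  then have "shadow_sum ?J ?C \<le> shadow_sum ?J A"
    using assms(4) finite_compress[OF assms(1,2,4)] levels_compress[of i n I A]
    by (simp add: shadow_sum_slices)
  moreover have "finite I" using assms(2) finite_subset by blast
  ultimately show ?thesis
    using card_shadow_compress_le[OF assms(1-4)] assms(1) by (simp add: shadow_sum_remove)
qed

text \<open>
  The points \<open>x\<close> and \<open>y\<close> witness that the section \<open>y i\<close> of \<open>A\<close> is not initial; there the weight
  drops, and it grows in no section.
\<close>
lemma weight_compress_less:
  fixes w :: "(nat \<Rightarrow> nat) \<Rightarrow> nat"
  assumes "i \<in> I" "I \<subseteq> {1..n}" "A \<subseteq> supported n I" "finite A"
    and w: "\<And>x y. x \<in> supported n I \<Longrightarrow> y \<in> supported n I \<Longrightarrow> cube_less n x y \<Longrightarrow> w x < w y"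
    and xy: "x \<in> supported n I" "x \<notin> A" "y \<in> A" "cube_less n x y" "x i = y i"
  shows "sum w (compress n I i A) < sum w A"
proof -
  let ?C = "compress n I i A" and ?J = "I - {i}" and ?T = "(\<lambda>a. a i) ` A"
  have less: "sum w (slice i t ?C) < sum w (slice i t A)"
    if "shadow i (slice i t ?C) \<noteq> shadow i (slice i t A)" for t
    unfolding sum_shadow_slice[symmetric, of w i t]
  proof (rule initial_sum_less[of n ?J])
    show "initial n ?J (shadow i (slice i t ?C))" "finite (shadow i (slice i t ?C))"
      unfolding shadow_slice_compress[OF assms(1,2)] by (rule initial_segment finite_segment)+
    show "shadow i (slice i t A) \<subseteq> supported n ?J"
      by (rule shadow_slice_supported[OF assms(1-3)])
    show "finite (shadow i (slice i t A))" using assms(4) by (simp add: shadow_def slice_def)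
    show "card (shadow i (slice i t ?C)) = card (shadow i (slice i t A))"
      by (simp add: card_shadow_slice card_slice_compress[OF assms(1-4)])
    show "w (u(i := t)) < w (v(i := t))"
      if "u \<in> supported n ?J" "v \<in> supported n ?J" "cube_less n u v" for u v
    proof (intro w cube_less_update that(3))
      show "u i = v i" using that(1,2)[THEN supported_insert(2)] assms(1,2) by simp
    qed (use that supported_insert[OF _ assms(1,2)] in auto)
  qed (rule that)
  have le: "sum w (slice i t ?C) \<le> sum w (slice i t A)" for t
    using less[of t] sum_shadow_slice[of w i t A] sum_shadow_slice[of w i t ?C]
    by (cases "shadow i (slice i t ?C) = shadow i (slice i t A)") auto
  have "shadow i (slice i (y i) ?C) \<noteq> shadow i (slice i (y i) A)"
  proof
    assume eq: "shadow i (slice i (y i) ?C) = shadow i (slice i (y i) A)"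
    have "y(i := 0) \<in> shadow i (slice i (y i) A)" using xy(3) by (auto simp: shadow_def slice_def)
    moreover have "initial n ?J (shadow i (slice i (y i) A))"
      unfolding eq[symmetric] shadow_slice_compress[OF assms(1,2)] by (rule initial_segment)
    ultimately have "x(i := 0) \<in> shadow i (slice i (y i) A)"
      using cube_less_update[of x i y n 0] xy supported_remove[OF xy(1) assms(1,2)]
      unfolding initial_def by blast
    then obtain a where a: "a \<in> A" "a i = x i" "x(i := 0) = a(i := 0)"
      using xy(5) by (auto simp: shadow_def slice_def)
    then have "x = a" by (metis fun_upd_triv fun_upd_upd)
    with a xy(2) show False by simp
  qed
  then have "(\<Sum>t\<in>?T. sum w (slice i t ?C)) < (\<Sum>t\<in>?T. sum w (slice i t A))"
    using less le xy(3) assms(4) by (intro sum_strict_mono_ex1) auto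
  then show ?thesis
    using assms(4) finite_compress[OF assms(1,2,4)] levels_compress[of i n I A]
    by (simp add: sum_slices)
qed

section \<open>Exchange of the last points for the first gaps\<close>

text \<open>
  Sections are compared here without projecting them, which is equivalent by \<open>cube_less_update\<close> and
  allows arguing about points that lie in several sections at once.
\<close>
definition sections_initial :: "nat \<Rightarrow> nat set \<Rightarrow> (nat \<Rightarrow> nat) set \<Rightarrow> bool" where
  "sections_initial n I A \<longleftrightarrow>
    (\<forall>x\<in>supported n I. \<forall>y\<in>A. cube_less n x y \<and> (\<exists>i\<in>I. x i = y i) \<longrightarrow> x \<in> A)"

definition down_closed :: "nat \<Rightarrow> nat set \<Rightarrow> (nat \<Rightarrow> nat) set \<Rightarrow> bool" where
  "down_closed n I A \<longleftrightarrow>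
    (\<forall>u\<in>supported n I. \<forall>v\<in>A. (\<forall>i\<in>I. u i \<le> v i) \<longrightarrow> u \<in> A)"

definition zeros :: "nat set \<Rightarrow> (nat \<Rightarrow> nat) \<Rightarrow> nat" where
  "zeros I a = card {i \<in> I. a i = 0}"

text \<open>
  For a set closed under decreasing coordinates, the projection along \<open>i\<close> consists of the points
  with \<open>i\<close>-th coordinate zero; count the pairs of such a point and a zero coordinate in two ways.
\<close>
lemma shadow_sum_down_closed:
  assumes "I \<subseteq> {1..n}" "A \<subseteq> supported n I" "finite A" "down_closed n I A"
  shows "shadow_sum I A = sum (zeros I) A"
proof -
  have fin: "finite I" using assms(1) finite_subset by blast
  have "shadow i A = {a \<in> A. a i = 0}" if "i \<in> I" for i
  proof
    show "shadow i A \<subseteq> {a \<in> A. a i = 0}"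
    proof
      fix u assume "u \<in> shadow i A"
      then obtain a where a: "a \<in> A" "u = a(i := 0)" by (auto simp: shadow_def)
      then have "u \<in> supported n I" using supported_update[of a] assms(1,2) that by blast
      moreover have "\<forall>k\<in>I. u k \<le> a k" using a by simp
      ultimately have "u \<in> A" using a(1) assms(4) unfolding down_closed_def by blast
      with a(2) show "u \<in> {a \<in> A. a i = 0}" by simp
    qed
    show "{a \<in> A. a i = 0} \<subseteq> shadow i A"
      unfolding shadow_def by (auto simp: image_iff) (metis fun_upd_triv)
  qed
  then have "shadow_sum I A = (\<Sum>i\<in>I. \<Sum>a | a \<in> A \<and> a i = 0. 1)"
    by (simp add: shadow_sum_def)
  also have "\<dots> = (\<Sum>a\<in>A. \<Sum>i | i \<in> I \<and> a i = 0. 1)"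
    by (rule sum.swap_restrict[OF fin assms(3)])
  finally show ?thesis by (simp add: zeros_def)
qed

text \<open>
  Decreasing some coordinates while keeping one stays within a section. With two coordinates at
  hand, a general decrease is a composition of two such steps: the first changes only \<open>k\<close>, the
  second keeps \<open>k\<close>.
\<close>
lemma down_closed_if_sections_initial:
  assumes "I \<subseteq> {1..n}" "A \<subseteq> supported n I" "sections_initial n I A" "i \<in> I" "k \<in> I" "i \<noteq> k"
  shows "down_closed n I A"
  unfolding down_closed_def
proof (intro ballI impI)
  fix u v assume u: "u \<in> supported n I" and v: "v \<in> A" and le: "\<forall>i\<in>I. u i \<le> v i"
  have vs: "v \<in> supported n I" using v assms(2) by blast
  have step: "a \<in> A" if "a \<in> supported n I" "b \<in> A" "\<forall>i\<in>I. a i \<le> b i" "q \<in> I" "a q = b q" for a b q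
  proof (cases "a = b")
    case False
    then have "cube_less n a b" using that cube_less_if_le assms(2) by blast
    with that assms(3) show ?thesis unfolding sections_initial_def by blast
  qed (use that in simp)
  define z where "z = v(k := u k)"
  have zs: "z \<in> supported n I" unfolding z_def by (rule supported_update[OF vs assms(5,1)])
  have "z \<in> A"
    by (rule step[OF zs v _ assms(4)]) (use le assms in \<open>auto simp: z_def\<close>)
  then show "u \<in> A"
    by (rule step[OF u _ _ assms(5)]) (use le in \<open>auto simp: z_def\<close>)
qed

text \<open>
  Points \<open>x \<notin> A\<close> and \<open>y \<in> A\<close> with \<open>x\<close> before \<open>y\<close> cannot lie in a common section, nor can there be
  a point between them that shares a section with each of the two. The level \<open>l\<close> and the coordinate
  \<open>j\<close> come from the comparison of \<open>x\<close> and \<open>y\<close>: as they differ everywhere, there are no coordinates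
  above \<open>l\<close>. If \<open>x k < y k\<close> for some other \<open>k\<close>, then \<open>x(k := y k)\<close> would be such a point between them.
\<close>
lemma first_gap_vs_last_point:
  assumes I: "I \<subseteq> {1..n}" and A: "A \<subseteq> supported n I" "sections_initial n I A"
    and x: "x \<in> supported n I" "x \<notin> A" and y: "y \<in> A" and xy: "cube_less n x y"
  obtains j l where "j \<in> I" "x j < l" "y j = l" "\<forall>i\<in>I. x i \<le> l \<and> y i \<le> l"
    "\<forall>i\<in>I. i > j \<longrightarrow> x i < l \<and> y i < l" "\<forall>k\<in>I. k \<noteq> j \<longrightarrow> y k < x k"
proof -
  have ys: "y \<in> supported n I" using A y by blast
  have neq: "x k \<noteq> y k" if "k \<in> I" for k
    using A(2) x y xy that unfolding sections_initial_def by blast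
  from xy obtain l j where j: "j \<in> {1..n}" "x j < l" "y j = l"
    and above: "\<And>k. k \<in> {1..n} \<Longrightarrow> x k > l \<or> y k > l \<Longrightarrow> x k = y k"
    and right: "\<And>k. k \<in> {1..n} \<Longrightarrow> k > j \<Longrightarrow> x k = l \<longleftrightarrow> y k = l"
    unfolding cube_less_iff by blast
  have jI: "j \<in> I"
    using j ys by (auto simp: supported_def Ball_def)
  have le: "x i \<le> l \<and> y i \<le> l" if "i \<in> I" for i
    using above[of i] neq[of i] I that by (meson not_less subsetD)
  have lt: "x i < l \<and> y i < l" if "i \<in> I" "i > j" for i
    using right[of i] neq[of i] le[of i] I that by (metis le_neq_implies_less subsetD)
  have "y k < x k" if k: "k \<in> I" "k \<noteq> j" for k
  proof (rule ccontr)
    assume "\<not> y k < x k"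
    then have less: "x k < y k" using neq[OF k(1)] by simp
    define z where "z = x(k := y k)"
    have zs: "z \<in> supported n I" unfolding z_def by (rule supported_update[OF x(1) k(1) I])
    have zI: "z i = y i" if "i \<in> {1..n}" "i \<notin> I" for i
      using that zs ys by (auto simp: supported_def)
    have "cube_less n z y"
    proof (rule cube_lessI[of j n z l y])
      show "z i = y i" if "i \<in> {1..n}" "z i > l \<or> y i > l" for i
        using that le[of i] zI[of i] le[OF k(1)] by (cases "i \<in> I") (auto simp: z_def split: if_splits)
      show "z i = l \<longleftrightarrow> y i = l" if "i \<in> {1..n}" "i > j" for i
        using that lt[of i] zI[of i] by (cases "i \<in> I") (auto simp: z_def split: if_splits)
    qed (use j k in \<open>auto simp: z_def\<close>)
    then have "z \<in> A" using A(2) zs y k(1) unfolding sections_initial_def z_def by (metis fun_upd_same)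
    moreover have "x \<noteq> z" using less unfolding z_def by (metis fun_upd_same less_irrefl)
    then have "cube_less n x z"
      using less by (intro cube_less_if_le[OF x(1) zs]) (auto simp: z_def)
    ultimately have "x \<in> A"
      using A(2) x(1) jI k(2) unfolding sections_initial_def z_def by (metis fun_upd_other)
    with x(2) show False by simp
  qed
  with that[of j l] jI j le lt show thesis by blast
qed

text \<open>
  The runs of points that are exchanged are consecutive in the cube order. For the run below \<open>y\<close>
  this is because \<open>y p\<close> is a least coordinate, for the run above \<open>x\<close> because the raised coordinate
  \<open>j\<close> remains below all other coordinates of \<open>x\<close>, which exceed those of \<open>y\<close>. Therefore the new
  set is again closed under decreasing coordinates, and zeros can be counted before and after.
\<close>
lemma exchange_decreases_weight:
  fixes w :: "(nat \<Rightarrow> nat) \<Rightarrow> nat"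
  assumes I: "I \<subseteq> {1..n}" and two: "\<And>j. \<exists>k\<in>I. k \<noteq> j"
    and A: "A \<subseteq> supported n I" "finite A" "sections_initial n I A"
    and x: "x \<in> supported n I" "x \<notin> A" "\<And>u. u \<in> supported n I \<Longrightarrow> cube_less n u x \<Longrightarrow> u \<in> A"
    and y: "y \<in> A" "\<And>u. u \<in> A \<Longrightarrow> u \<noteq> y \<Longrightarrow> cube_less n u y" and xy: "cube_less n x y"
    and w: "\<And>x y. x \<in> supported n I \<Longrightarrow> y \<in> supported n I \<Longrightarrow> cube_less n x y \<Longrightarrow> w x < w y"
  obtains A' where "A' \<subseteq> supported n I" "finite A'" "card A' = card A"
    "shadow_sum I A' \<le> shadow_sum I A" "sum w A' < sum w A"
proof -
  have finI: "finite I" using I finite_subset by blast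
  have ys: "y \<in> supported n I" using A y by blast
  have down: "down_closed n I A"
    using two down_closed_if_sections_initial[OF I A(1,3)] by metis
  obtain j l where j: "j \<in> I" "x j < l" "y j = l"
    and bounds: "\<forall>i\<in>I. x i \<le> l \<and> y i \<le> l" "\<forall>i\<in>I. i > j \<longrightarrow> x i < l \<and> y i < l"
      "\<forall>k\<in>I. k \<noteq> j \<longrightarrow> y k < x k"
    by (rule first_gap_vs_last_point[OF I A(1,3) x(1,2) y(1) xy])
  note le = bounds(1)[rule_format] and lt = bounds(2)[rule_format] and big = bounds(3)[rule_format]
  obtain p where p: "p \<in> I" "\<And>k. k \<in> I \<Longrightarrow> y p \<le> y k"
  proof -
    have "Min (y ` I) \<in> y ` I" using finI j(1) by (intro Min_in) auto
    then obtain p where "p \<in> I" "y p = Min (y ` I)" by auto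
    with that[of p] finI show thesis by simp
  qed
  obtain k0 where k0: "k0 \<in> I" "k0 \<noteq> j" using two by blast
  have pl: "y p < l"
    using p(2)[OF k0(1)] big[OF k0] le[OF k0(1)] by linarith
  have pj: "p \<noteq> j" using pl j(3) by auto
  \<comment> \<open>If \<open>x j > 0\<close>, then \<open>x\<close> has no zero at all, and exchanging the single points \<open>y\<close> and \<open>x\<close> suffices.\<close>
  define d where "d = (if x j = 0 then y p else 0)"
  define f where "f s = y(p := y p - s)" for s
  define g where "g s = x(j := x j + s)" for s
  define R where "R = f ` {..d}"
  define T where "T = g ` {..d}"
  define A' where "A' = (A - R) \<union> T"
  have d: "d \<le> y p" by (simp add: d_def)
  have fs: "f s \<in> supported n I" and gs: "g s \<in> supported n I" for s
    unfolding f_def g_def using supported_update[OF ys p(1) I] supported_update[OF x(1) j(1) I] by auto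
  have fA: "f s \<in> A" for s
  proof -
    have "\<forall>i\<in>I. f s i \<le> y i" by (simp add: f_def)
    with down y(1) fs[of s] show ?thesis unfolding down_closed_def by blast
  qed
  have gA: "g s \<notin> A" for s
  proof
    assume "g s \<in> A"
    moreover have "\<forall>i\<in>I. x i \<le> g s i" by (simp add: g_def)
    ultimately show False using down x(1,2) unfolding down_closed_def by blast
  qed
  have RA: "R \<subseteq> A" and TA: "T \<inter> A = {}"
    using fA gA by (auto simp: R_def T_def)
  have injf: "inj_on f {..d}"
  proof (rule inj_onI)
    fix s t assume st: "s \<in> {..d}" "t \<in> {..d}" and "f s = f t"
    then have "f s p = f t p" by simp
    then have "y p - s = y p - t" by (simp add: f_def)
    with st d show "s = t" by simp
  qed
  have injg: "inj_on g {..d}"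
  proof (rule inj_onI)
    fix s t assume "g s = g t"
    then have "g s j = g t j" by simp
    then show "s = t" by (simp add: g_def)
  qed
  have cRT: "card R = card T"
    unfolding R_def T_def by (simp add: card_image injf injg)
  have fin: "finite R" "finite T" "finite A'"
    using A(2) by (auto simp: R_def T_def A'_def)
  have sup: "A' \<subseteq> supported n I" using A(1) gs by (auto simp: A'_def T_def)
  have sum_A': "sum h A' + sum h R = sum h A + sum h T" for h :: "(nat \<Rightarrow> nat) \<Rightarrow> nat"
  proof -
    have "sum h A' = sum h (A - R) + sum h T"
      unfolding A'_def using A(2) fin TA by (intro sum.union_disjoint) auto
    moreover have "sum h A = sum h (A - R) + sum h R"
      using sum.subset_diff[OF RA A(2)] .
    ultimately show ?thesis by simp
  qed
  have down': "down_closed n I A'"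
    unfolding down_closed_def
  proof (intro ballI impI)
    fix u v assume u: "u \<in> supported n I" and v: "v \<in> A'" and uv: "\<forall>i\<in>I. u i \<le> v i"
    show "u \<in> A'"
    proof (cases "v \<in> T")
      case False
      then have v: "v \<in> A" "v \<notin> R" using v by (auto simp: A'_def)
      then have "u \<in> A" using down u uv unfolding down_closed_def by blast
      moreover have "u \<notin> R"
      proof
        assume "u \<in> R"
        then obtain s where s: "s \<le> d" "u = f s" by (auto simp: R_def)
        \<comment> \<open>Coordinatewise \<open>v\<close> is above \<open>u\<close>, yet it does not come after \<open>y\<close>; since \<open>y p\<close> is a least
          coordinate, this leaves only points of the run below \<open>y\<close>.\<close>
        have "f 0 = y" by (simp add: f_def)
        then have "y \<in> R" unfolding R_def by (metis atMost_iff image_eqI le0)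
        then have "v \<noteq> y" using v(2) by blast
        with y(2) v(1) have "cube_less n v y" by blast
        then obtain l' q where q: "q \<in> {1..n}" "v q < l'" "y q = l'"
          and above: "\<And>k. k \<in> {1..n} \<Longrightarrow> v k > l' \<or> y k > l' \<Longrightarrow> v k = y k"
          unfolding cube_less_iff by blast
        have "q \<in> I" using q ys by (auto simp: supported_def Ball_def)
        then have "u q < y q" using q uv by fastforce
        then have "q = p" using s by (auto simp: f_def split: if_splits)
        have "v k = f (y p - v p) k" if "k \<in> I" for k
        proof (cases "k = p")
          case True
          then show ?thesis using q \<open>q = p\<close> by (simp add: f_def)
        next
          case False
          then have "y k \<le> v k" using bspec[OF uv that] s by (simp add: f_def)
          moreover have "y p \<le> y k" using p(2) that .
          moreover have "v k = y k" if "v k > y p \<or> y k > y p"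
            using above[of k] that q \<open>q = p\<close> \<open>k \<in> I\<close> I by auto
          ultimately have "v k = y k" by linarith
          with False show ?thesis by (simp add: f_def)
        qed
        then have "v = f (y p - v p)"
          using supported_eqI fs v(1) A(1) by blast
        moreover have "y p - v p \<le> d"
          using bspec[OF uv p(1)] s by (simp add: f_def)
        ultimately show False using v(2) by (auto simp: R_def)
      qed
      ultimately show ?thesis by (simp add: A'_def)
    next
      case True
      then obtain t where t: "t \<le> d" "v = g t" by (auto simp: T_def)
      have ux: "u i \<le> x i" if "i \<in> I" "i \<noteq> j" for i
        using bspec[OF uv that(1)] t that(2) by (simp add: g_def)
      have uj: "u j \<le> x j + t" using bspec[OF uv j(1)] t by (simp add: g_def)
      have small: "x j + t < l"
        using t j(2) pl by (auto simp: d_def split: if_splits)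
      have "u \<notin> R"
      proof
        assume "u \<in> R"
        then have "u j = l" using pj j(3) by (auto simp: R_def f_def)
        with uj small show False by simp
      qed
      moreover have "u \<in> A \<union> T"
      proof (cases "cube_less n x u")
        case False
        then have "u = x \<or> cube_less n u x"
          using cube_less_linear u x(1) supported_nspace by blast
        moreover have "g 0 = x" by (simp add: g_def)
        then have "x \<in> T" unfolding T_def by (metis atMost_iff image_eqI le0)
        ultimately show ?thesis using x(3) u by blast
      next
        case True
        \<comment> \<open>The only coordinate in which \<open>u\<close> can exceed \<open>x\<close> is \<open>j\<close>, so it decides the comparison;
          its value \<open>u j\<close> is below all other coordinates of \<open>x\<close>, hence these agree with those of \<open>u\<close>.\<close>
        then obtain l' q where q: "q \<in> {1..n}" "x q < l'" "u q = l'"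
          and above: "\<And>k. k \<in> {1..n} \<Longrightarrow> x k > l' \<or> u k > l' \<Longrightarrow> x k = u k"
          unfolding cube_less_iff by blast
        have "q \<in> I" using q u by (auto simp: supported_def Ball_def)
        with ux[of q] q have "q = j" by linarith
        with q uj have "t > 0" by simp
        then have x0: "x j = 0" and dp: "d = y p" using t(1) by (auto simp: d_def split: if_splits)
        have "u k = g (u j) k" if "k \<in> I" for k
        proof (cases "k = j")
          case True then show ?thesis by (simp add: g_def x0)
        next
          case False
          have "u j \<le> y p" using uj x0 t(1) dp by simp
          also have "y p < x k" using p(2)[OF that] big[OF that False] by simp
          finally have "x k > l'" using q \<open>q = j\<close> by simp
          then have "x k = u k" using above[of k] that I by auto
          with False show ?thesis by (simp add: g_def)
        qed
        then have "u = g (u j)" using supported_eqI u gs by blast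
        moreover have "u j \<le> d" using uj x0 t(1) by simp
        ultimately show ?thesis unfolding T_def by blast
      qed
      ultimately show ?thesis by (auto simp: A'_def)
    qed
  qed
  have zg: "{i \<in> I. g s i = 0} = (if x j + s = 0 then {j} else {})" for s
  proof -
    have "g s i = 0 \<longleftrightarrow> i = j \<and> x j + s = 0" if "i \<in> I" for i
      using big[OF that] by (cases "i = j") (auto simp: g_def)
    then show ?thesis using j(1) by auto
  qed
  have "sum (zeros I) T \<le> sum (zeros I) R"
  proof (cases "x j = 0")
    case True
    have "sum (zeros I) T = (\<Sum>s\<le>d. if s = 0 then 1 else 0)"
      unfolding T_def sum.reindex[OF injg]
      by (rule sum.cong) (auto simp: zeros_def zg True)
    also have "\<dots> = 1" by simp
    also have "1 \<le> zeros I (f d)"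
    proof -
      have "p \<in> {i \<in> I. f d i = 0}" using p(1) True by (simp add: f_def d_def)
      then have "card {i \<in> I. f d i = 0} \<noteq> 0" using finI by auto
      then show ?thesis by (simp add: zeros_def)
    qed
    also have "\<dots> \<le> sum (zeros I) R"
      using fin by (intro member_le_sum) (auto simp: R_def)
    finally show ?thesis .
  next
    case False
    then have "sum (zeros I) T = 0"
      unfolding T_def sum.reindex[OF injg] by (intro sum.neutral) (auto simp: zeros_def zg)
    then show ?thesis by simp
  qed
  then have "sum (zeros I) A' \<le> sum (zeros I) A" using sum_A'[of "zeros I"] by simp
  then have "shadow_sum I A' \<le> shadow_sum I A"
    using shadow_sum_down_closed[OF I sup fin(3) down'] shadow_sum_down_closed[OF I A(1,2) down]
    by simp
  moreover have "sum w A' < sum w A"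
  proof -
    have "cube_less n (g s) (f s)" if "s \<le> d" for s
    proof (rule cube_lessI[of j n "g s" l "f s"])
      have small: "x j + s < l"
        using that j(2) pl by (auto simp: d_def split: if_splits)
      then show "g s j < l" by (simp add: g_def)
      show "j \<in> {1..n}" using j I by blast
      show "f s j = l" using pj j(3) by (simp add: f_def)
      have bound: "g s i \<le> l \<and> f s i \<le> l" if "i \<in> I" for i
        using le[OF that] small by (auto simp: g_def f_def)
      have out: "g s i = f s i" if "i \<in> {1..n}" "i \<notin> I" for i
        using that gs[of s] fs[of s] by (simp add: supported_def)
      show "g s i = f s i" if "i \<in> {1..n}" "g s i > l \<or> f s i > l" for i
        using that bound[of i] out[of i] by (cases "i \<in> I") auto
      show "g s i = l \<longleftrightarrow> f s i = l" if "i \<in> {1..n}" "i > j" for i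
      proof (cases "i \<in> I")
        case True
        then have "g s i < l \<and> f s i < l" using lt[OF True that(2)] that(2) by (auto simp: g_def f_def)
        then show ?thesis by simp
      next
        case False
        then show ?thesis using out that(1) by simp
      qed
    qed
    then have "(\<Sum>s\<le>d. w (g s)) < (\<Sum>s\<le>d. w (f s))"
      using gs fs w by (intro sum_strict_mono) auto
    then have "sum w T < sum w R"
      by (simp add: T_def R_def sum.reindex[OF injg] sum.reindex[OF injf])
    then show ?thesis using sum_A'[of w] by simp
  qed
  moreover have "card A' = card A" using sum_A'[of "\<lambda>_. 1"] cRT by simp
  ultimately show thesis using that[of A'] sup fin by blast
qed

section \<open>Initial segments minimise the sum of projections\<close>

text \<open>
  Dimension one is separate because the sections are single points there: compression changes
  nothing and exchanging needs a second coordinate. Any nonempty set has a projection of size one.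
\<close>
lemma shadow_sum_segment_le_singleton:
  assumes "A \<subseteq> supported n {i}" "i \<in> {1..n}" "finite A"
  shows "shadow_sum {i} (segment n {i} (card A)) \<le> shadow_sum {i} A"
proof (cases "A = {}")
  case True
  then show ?thesis by (simp add: shadow_sum_def shadow_def segment_def)
next
  case False
  have "x = y" if "x \<in> supported n {}" "y \<in> supported n {}" for x y
    using supported_eqI[OF that] by simp
  moreover have "shadow i (segment n {i} (card A)) \<subseteq> supported n {}"
    using supported_remove[of _ n "{i}" i] assms(2) by (auto simp: shadow_def segment_def)
  ultimately have "card (shadow i (segment n {i} (card A))) \<le> 1"
    by (intro card_le_Suc0_iff_eq[THEN iffD2, simplified One_nat_def[symmetric]])
      (auto simp: shadow_def finite_segment)
  also have "1 \<le> card (shadow i A)"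
    using False assms(3) by (simp add: shadow_def Suc_le_eq card_gt_0_iff)
  finally show ?thesis by (simp add: shadow_sum_def)
qed

text \<open>
  Induction on \<open>I\<close>, and within it on the weight \<open>sum w A\<close>, which both kinds of replacement decrease
  while they keep the size and do not increase \<open>shadow_sum I A\<close>. A set that admits neither is the
  initial segment itself.
\<close>
lemma shadow_sum_segment_le:
  assumes "I \<subseteq> {1..n}" "A \<subseteq> supported n I" "finite A"
  shows "shadow_sum I (segment n I (card A)) \<le> shadow_sum I A"
proof -
  have "finite I" using assms(1) finite_subset by blast
  then show ?thesis using assms
  proof (induction I arbitrary: A rule: finite_psubset_induct)
    case (psubset I)
    define w where "w x = card (cube_preds n x)" for x
    have w: "w x < w y" if "x \<in> supported n I" "cube_less n x y" for x y
      unfolding w_def using that by (intro card_cube_preds_mono supported_nspace)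
    have IH: "shadow_sum (I - {i}) (segment n (I - {i}) (card B)) \<le> shadow_sum (I - {i}) B"
      if "i \<in> I" "finite B" "B \<subseteq> supported n (I - {i})" for i B
      using that psubset.prems(1) by (intro psubset.IH) auto
    consider "I = {}" | i where "I = {i}" | "\<forall>j. \<exists>k\<in>I. k \<noteq> j"
    proof (cases "\<forall>j. \<exists>k\<in>I. k \<noteq> j")
      case False
      then obtain j where "I \<subseteq> {j}" by blast
      then show thesis using that(1,2) subset_singletonD by blast
    qed (rule that(3))
    then show ?case
    proof cases
      case 1
      then show ?thesis by (simp add: shadow_sum_def)
    next
      case 2
      with psubset.prems show ?thesis using shadow_sum_segment_le_singleton by simp
    next
      case 3
      from psubset.prems(2,3) show ?thesis
      proof (induction "sum w A" arbitrary: A rule: less_induct)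
        case less
        have improve: ?case if "A' \<subseteq> supported n I" "finite A'" "card A' = card A"
          "shadow_sum I A' \<le> shadow_sum I A" "sum w A' < sum w A" for A'
          using less.hyps[OF that(5,1,2)] that(3,4) by simp
        show ?case
        proof (cases "initial n I A")
          case True
          have "segment n I (card A) = A"
            by (rule initial_unique[OF initial_segment True finite_segment less.prems(2)
                  card_segment[OF less.prems(2,1)]])
          then show ?thesis by simp
        next
          case not_initial: False
          show ?thesis
          proof (cases "sections_initial n I A")
            case False
            then obtain x y i where xy: "x \<in> supported n I" "x \<notin> A" "y \<in> A" "cube_less n x y"
              and i: "i \<in> I" "x i = y i"
              unfolding sections_initial_def by blast
            note * = i(1) psubset.prems(1) less.prems
            show ?thesis
            proof (rule improve)
              show "compress n I i A \<subseteq> supported n I" by (auto simp: compress_def)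
              show "finite (compress n I i A)" by (rule finite_compress[OF *(1,2,4)])
              show "card (compress n I i A) = card A" by (rule card_compress[OF *])
              show "shadow_sum I (compress n I i A) \<le> shadow_sum I A"
                by (rule shadow_sum_compress_le[OF * IH[OF i(1)]])
              show "sum w (compress n I i A) < sum w A"
                by (rule weight_compress_less[OF * w xy i(2)])
            qed
          next
            case True
            from not_initial less.prems(1) obtain x0 y0 where xy0: "x0 \<in> supported n I" "x0 \<notin> A"
              "y0 \<in> A" "cube_less n x0 y0"
              unfolding initial_def by blast
            define gap where "gap u \<longleftrightarrow> u \<in> supported n I \<and> u \<notin> A" for u
            define x where "x = arg_min w gap"
            have x: "gap x" "\<And>u. gap u \<Longrightarrow> w x \<le> w u"
              unfolding x_def using arg_min_natI[of gap x0 w] arg_min_nat_le[of gap _ w] xy0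
              by (auto simp: gap_def)
            have "Max (w ` A) \<in> w ` A" using xy0 less.prems(2) by (intro Max_in) auto
            then obtain y where "y \<in> A" "w y = Max (w ` A)" by auto
            then have y: "y \<in> A" "\<And>u. u \<in> A \<Longrightarrow> w u \<le> w y" using less.prems(2) by auto
            have ord: "cube_less n u v" if "u \<in> supported n I" "v \<in> supported n I" "u \<noteq> v" "w u \<le> w v" for u v
              using that w[of v u] cube_less_linear[of u n v] by (metis leD supported_nspace)
            have xs: "x \<in> supported n I" and xA: "x \<notin> A" and ys: "y \<in> supported n I"
              using x(1) y(1) less.prems(1) by (auto simp: gap_def)
            have "w x \<le> w x0" using x(2) xy0 by (simp add: gap_def)
            also have "\<dots> < w y0" using w xy0 by blast
            also have "\<dots> \<le> w y" using y xy0 by blast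
            finally have xy: "cube_less n x y" using ord[OF xs ys] by fastforce
            have below: "u \<in> A" if "u \<in> supported n I" "cube_less n u x" for u
              using x(2)[of u] w[OF that] that(1) by (auto simp: gap_def)
            have above: "cube_less n u y" if "u \<in> A" "u \<noteq> y" for u
              using ord[OF _ ys that(2) y(2)[OF that(1)]] that(1) less.prems(1) by blast
            obtain A' where "A' \<subseteq> supported n I" "finite A'" "card A' = card A"
              "shadow_sum I A' \<le> shadow_sum I A" "sum w A' < sum w A"
              by (rule exchange_decreases_weight[OF psubset.prems(1) 3[rule_format] less.prems True
                    xs xA below y(1) above xy w])
            then show ?thesis by (rule improve)
          qed
        qed
      qed
    qed
  qed
qed

section \<open>Transfer to real vectors\<close>

lemma card_image_factor_le:
  assumes "finite A" "\<And>a. a \<in> A \<Longrightarrow> f a = h (g a)"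
  shows "card (f ` A) \<le> card (g ` A)"
proof -
  have "f ` A = h ` g ` A" using assms(2) by (auto simp: image_iff)
  then show ?thesis using card_image_le[of "g ` A" h] assms(1) by simp
qed

lemma cube_segment_eq_segment: "cube_segment n m = segment n {1..n} m"
proof -
  have "supported n {1..n} = nspace n" by (auto simp: supported_def)
  then show ?thesis
    by (auto simp: cube_segment_def segment_def rank_def cube_preds_def finite_cube_preds[unfolded cube_preds_def])
qed

text \<open>
  One injection \<open>g\<close> of the finitely many reals that occur as coordinates into the naturals is
  applied to all coordinates. Each projection of the relabelled set is then a function of
  the corresponding projection of \<open>A\<close>.
\<close>
lemma coordinatewise_relabelling:
  assumes "finite A" "A \<subseteq> rspace n"
  obtains B where "B \<subseteq> supported n {1..n}" "finite B" "card B = card A"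
    "\<And>i. i \<in> {1..n} \<Longrightarrow> card (shadow i B) \<le> card (coord_proj i ` A)"
proof -
  define V where "V = (\<Union>a\<in>A. a ` {1..n})"
  have "finite V" using assms(1) by (simp add: V_def)
  then obtain g :: "real \<Rightarrow> nat" where g: "inj_on g V"
    using finite_imp_inj_to_nat_seg by metis
  define H where "H a = (\<lambda>k\<in>{1..n}. g (a k))" for a
  have "inj_on H A"
  proof (rule inj_onI)
    fix a b assume ab: "a \<in> A" "b \<in> A" "H a = H b"
    show "a = b"
    proof (rule PiE_ext[of a "{1..n}" "\<lambda>_. UNIV" b])
      fix k assume k: "k \<in> {1..n}"
      then have "H a k = H b k" using ab by simp
      then have "g (a k) = g (b k)" using k by (simp add: H_def)
      moreover have "a k \<in> V" "b k \<in> V" using ab k unfolding V_def by blast+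
      ultimately show "a k = b k" using g by (simp add: inj_on_def)
    qed (use ab assms(2) in \<open>auto simp: rspace_def\<close>)
  qed
  then have "card (H ` A) = card A" by (rule card_image)
  moreover have "H ` A \<subseteq> supported n {1..n}"
    by (auto simp: H_def supported_def nspace_def)
  moreover have "card (shadow i (H ` A)) \<le> card (coord_proj i ` A)" if "i \<in> {1..n}" for i
    unfolding shadow_def image_image
  proof (rule card_image_factor_le[OF assms(1), where h = "\<lambda>b. (H b)(i := 0)"])
    show "(H a)(i := 0) = (H (coord_proj i a))(i := 0)" for a
      by (rule ext) (auto simp: H_def coord_proj_def restrict_def)
  qed
  ultimately show thesis using that assms(1) by blast
qed

lemma card_coord_proj_cube_segment_le:
  assumes "i \<in> {1..n}"
  shows "card (coord_proj i ` real_vec n ` cube_segment n m) \<le> card (shadow i (segment n {1..n} m))"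
  unfolding shadow_def cube_segment_eq_segment image_image
proof (rule card_image_factor_le[OF finite_segment, where h = "real_vec n"])
  show "coord_proj i (real_vec n x) = real_vec n (x(i := 0))" for x
    using assms by (intro ext) (auto simp: coord_proj_def real_vec_def restrict_def)
qed

theorem theorem1:
  fixes n m :: nat and A :: "(nat \<Rightarrow> real) set"
  assumes "n \<ge> 1" and "finite A" and "A \<subseteq> rspace n" and "m = card A"
  shows "(\<Sum>i=1..n. card (coord_proj i ` A))
    \<ge> (\<Sum>i=1..n. card (coord_proj i ` real_vec n ` cube_segment n m))"
proof -
  obtain B where B: "B \<subseteq> supported n {1..n}" "finite B" "card B = card A"
    and shadow_B: "\<And>i. i \<in> {1..n} \<Longrightarrow> card (shadow i B) \<le> card (coord_proj i ` A)"
    by (rule coordinatewise_relabelling[OF assms(2,3)]) blast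
  have "(\<Sum>i=1..n. card (coord_proj i ` real_vec n ` cube_segment n m))
      \<le> shadow_sum {1..n} (segment n {1..n} m)"
    unfolding shadow_sum_def by (intro sum_mono card_coord_proj_cube_segment_le)
  also have "\<dots> \<le> shadow_sum {1..n} B"
    using shadow_sum_segment_le[OF order_refl B(1,2)] B(3) assms(4) by simp
  also have "\<dots> \<le> (\<Sum>i=1..n. card (coord_proj i ` A))"
    unfolding shadow_sum_def by (intro sum_mono shadow_B)
  finally show ?thesis .
qed

end
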